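(* For any $m\ge 1$ and any $\tau\in\mathbb{Z}$, the value $f_m^\tau(1)$ at $q=1$ of $$f_{m}^{\tau}(q)=(q^{1/2}-q^{-1/2})\,[x^m]\,\mathrm{Log}\left(\sum_{n\geq 0}\frac{(-1)^{n(\tau-1)}q^{\frac{n(n-1)}{2}\tau+\frac{n^2}{2}}}{(1-q)(1-q^2)\cdots(1-q^n)}x^n\right)$$ satisfies $$f^{\tau}_{m}(1)=\frac{1}{m^2}\sum_{d\mid m}\mu(m/d)(-1)^{d\tau}\binom{d(\tau+1)-1}{d-1}\in\mathbb{Z}.$$
   Context: $\mu$ is the Möbius function. For $a\in\mathbb{Z}$ and an integer $r\ge0$, $\binom{a}{r}=\frac{a(a-1)\cdots(a-r+1)}{r!}$ (so $a$ may be negative). For a power series $F\in 1+x\,\mathbb{Q}(q^{1/2})[[x]]$, the plethystic logarithm is $$\mathrm{Log}(F)=\sum_{d\ge 1}\frac{\mu(d)}{d}\Psi_d(\log F),$$ where $\Psi_d$ is the $\mathbb{Q}$-algebra map replacing $x$ by $x^d$ and $q^{1/2}$ by $q^{d/2}$. $[x^m]G$ denotes the coefficient of $x^m$ in $G$. Thus $f_m^\tau$ is a rational function of $q^{1/2}$, and $f_m^\tau(1)$ is its value at $q^{1/2}=1$ (the limit as $q^{1/2}\to1$). *)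

theory Defs
  imports
    Complex_Main
    "HOL-Computational_Algebra.Computational_Algebra"
    "HOL-Computational_Algebra.Field_as_Ring"
begin

definition moebius_mu :: "nat \<Rightarrow> int" where
  "moebius_mu n = (if squarefree n then (-1) ^ card (prime_factors n) else 0)"


text \<open>
  The field \<open>\<rat>(q\<^sup>1\<^sup>/\<^sup>2)\<close> is represented by the fraction field of \<open>\<rat>[t]\<close>, where the
  polynomial variable \<open>t\<close> stands for \<open>q\<^sup>1\<^sup>/\<^sup>2\<close>.
\<close>

type_synonym ratfun = "rat poly fract"

definition q_half :: ratfun where
  "q_half = Fract [:0, 1:] 1"

definition q_var :: ratfun where
  "q_var = q_half ^ 2"

text \<open>
  The substitution \<open>t \<mapsto> t\<^sup>d\<close> on \<open>\<rat>(t)\<close>, computed on the reduced fraction; it does not depend on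
  the representation (\<open>ratfun_subst_power_Fract\<close>). It is only meaningful for \<open>d \<ge> 1\<close>, since at
  \<open>d = 0\<close> denominators may vanish.
\<close>

definition ratfun_subst_power :: "nat \<Rightarrow> ratfun \<Rightarrow> ratfun" where
  "ratfun_subst_power d f =
     (let (p, r) = quot_of_fract f in Fract (pcompose p (monom 1 d)) (pcompose r (monom 1 d)))"

lemma pcompose_monom_eq_0_iff:
  fixes p :: "rat poly"
  assumes "d \<ge> 1"
  shows "pcompose p (monom 1 d) = 0 \<longleftrightarrow> p = 0"
  using assms by (auto simp: degree_monom_eq dest: pcompose_eq_0)

lemma ratfun_subst_power_Fract:
  assumes "d \<ge> 1" "b \<noteq> 0"
  shows "ratfun_subst_power d (Fract a b) = Fract (pcompose a (monom 1 d)) (pcompose b (monom 1 d))"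
proof -
  obtain p r where pr: "quot_of_fract (Fract a b) = (p, r)" by fastforce
  have r: "r \<noteq> 0" using snd_quot_of_fract_nonzero[of "Fract a b"] pr by simp
  have "Fract p r = Fract a b" using Fract_quot_of_fract[of "Fract a b"] pr by simp
  then have "p * b = a * r" using r assms(2) by (simp add: eq_fract)
  then have "pcompose p (monom 1 d) * pcompose b (monom 1 d)
               = pcompose a (monom 1 d) * pcompose r (monom 1 d)"
    by (metis pcompose_mult)
  then show ?thesis
    using r assms by (simp add: ratfun_subst_power_def pr eq_fract pcompose_monom_eq_0_iff)
qed

definition Psi :: "nat \<Rightarrow> ratfun fps \<Rightarrow> ratfun fps" where
  "Psi d F = Abs_fps (\<lambda>n. if d dvd n then ratfun_subst_power d (F $ (n div d)) else 0)"

text \<open>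
  The library series \<open>fps_ln 1\<close> is \<open>log (1 + X)\<close>, so \<open>log F\<close> is its composition with \<open>F - 1\<close>.
\<close>

definition fps_log :: "ratfun fps \<Rightarrow> ratfun fps" where
  "fps_log F = fps_compose (fps_ln 1) (F - 1)"

text \<open>
  The infinite sum is taken in the \<open>X\<close>-adic topology, in which it converges whenever \<open>F\<close> has
  constant term 1; the index is shifted so that \<open>Suc d\<close> runs over the positive integers.
\<close>

definition plethystic_Log :: "ratfun fps \<Rightarrow> ratfun fps" where
  "plethystic_Log F =
     (\<Sum>d. fps_const (of_int (moebius_mu (Suc d)) / of_nat (Suc d)) * Psi (Suc d) (fps_log F))"

lemma ratfun_subst_power_0 [simp]: "ratfun_subst_power d 0 = 0"
  by (simp add: ratfun_subst_power_def fract_collapse)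

lemma Psi_nth_eq_0:
  assumes "F $ 0 = 0" "n < d"
  shows "Psi d F $ n = 0"
  using assms by (auto simp: Psi_def dest: dvd_imp_le)

lemma plethystic_Log_sums:
  assumes "F $ 0 = 1"
  shows "(\<lambda>d. fps_const (of_int (moebius_mu (Suc d)) / of_nat (Suc d)) * Psi (Suc d) (fps_log F))
           sums Abs_fps (\<lambda>n. \<Sum>d<n. of_int (moebius_mu (Suc d)) / of_nat (Suc d)
                               * Psi (Suc d) (fps_log F) $ n)"
    (is "?f sums ?S")
  unfolding sums_def
proof (rule tendsto_fpsI)
  fix n
  have log0: "fps_log F $ 0 = 0" by (simp add: fps_log_def)
  have "(\<Sum>d<N. ?f d) $ n = ?S $ n" if "N \<ge> n" for N
  proof -
    have "(\<Sum>d<N. ?f d) $ n = (\<Sum>d<N. ?f d $ n)" by (simp add: fps_sum_nth)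
    also have "\<dots> = (\<Sum>d<n. ?f d $ n)"
      using that by (intro sum.mono_neutral_right) (auto simp: Psi_nth_eq_0[OF log0])
    finally show ?thesis by simp
  qed
  then show "eventually (\<lambda>N. (\<Sum>d<N. ?f d) $ n = ?S $ n) sequentially"
    by (auto simp: eventually_at_top_linorder)
qed

lemma plethystic_Log_nth:
  assumes "F $ 0 = 1"
  shows "plethystic_Log F $ n =
           (\<Sum>d<n. of_int (moebius_mu (Suc d)) / of_nat (Suc d) * Psi (Suc d) (fps_log F) $ n)"
  unfolding plethystic_Log_def plethystic_Log_sums[OF assms, THEN sums_unique, symmetric]
  by (simp only: fps_nth_Abs_fps)


text \<open>
  \<open>ratfun_has_value f a v\<close>: the rational function \<open>f\<close> is regular at \<open>a\<close> (some representation as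
  a fraction has a denominator not vanishing at \<open>a\<close>) and takes the value \<open>v\<close> there. The lemmas
  below show that \<open>v\<close> is unique, and that it is the limit at \<open>a\<close> of the real function obtained
  from an arbitrary, possibly unreduced, representation of \<open>f\<close>.
\<close>

definition ratfun_has_value :: "ratfun \<Rightarrow> rat \<Rightarrow> rat \<Rightarrow> bool" where
  "ratfun_has_value f a v \<longleftrightarrow>
     (\<exists>p r. f = Fract p r \<and> poly r a \<noteq> 0 \<and> v = poly p a / poly r a)"

lemma ratfun_has_value_unique:
  assumes "ratfun_has_value f a v" "ratfun_has_value f a w"
  shows "v = w"
proof -
  obtain p r where 1: "f = Fract p r" "poly r a \<noteq> 0" "v = poly p a / poly r a"
    using assms(1) by (auto simp: ratfun_has_value_def)
  obtain p' r' where 2: "f = Fract p' r'" "poly r' a \<noteq> 0" "w = poly p' a / poly r' a"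
    using assms(2) by (auto simp: ratfun_has_value_def)
  have "r \<noteq> 0" "r' \<noteq> 0" using 1 2 by auto
  then have "p * r' = p' * r" using 1 2 by (simp add: eq_fract)
  then have "poly p a * poly r' a = poly p' a * poly r a" by (metis poly_mult)
  then show ?thesis using 1 2 by (simp add: frac_eq_eq)
qed

lemma poly_map_poly_of_rat: "poly (map_poly of_rat p) (of_rat x) = (of_rat (poly p x) :: real)"
  by (induction p) (auto simp: map_poly_pCons of_rat_add of_rat_mult)

lemma map_poly_of_rat_mult:
  "map_poly of_rat (p * q) = (map_poly of_rat p * map_poly of_rat q :: real poly)"
  by (intro poly_eqI) (simp add: coeff_map_poly coeff_mult of_rat_sum of_rat_mult)

lemma ratfun_has_value_limit:
  assumes "ratfun_has_value (Fract p r) a v" "r \<noteq> 0"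
  shows "((\<lambda>x::real. poly (map_poly of_rat p) x / poly (map_poly of_rat r) x)
            \<longlongrightarrow> of_rat v) (at (of_rat a))"
proof -
  let ?R = "map_poly of_rat :: rat poly \<Rightarrow> real poly"
  obtain p' r' where 1: "Fract p r = Fract p' r'" "poly r' a \<noteq> 0" "v = poly p' a / poly r' a"
    using assms(1) by (auto simp: ratfun_has_value_def)
  have r': "r' \<noteq> 0" using 1 by auto
  have "p * r' = p' * r" using 1(1) assms(2) r' by (simp add: eq_fract)
  then have eq: "?R p * ?R r' = ?R p' * ?R r" by (metis map_poly_of_rat_mult)
  have nz: "?R r * ?R r' \<noteq> 0"
    using assms(2) r' by (simp add: map_poly_eq_0_iff)
  have "((\<lambda>x. poly (?R p') x / poly (?R r') x) \<longlongrightarrow>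
           poly (?R p') (of_rat a) / poly (?R r') (of_rat a)) (at (of_rat a))"
    using 1(2) by (intro tendsto_intros) (auto simp: poly_map_poly_of_rat)
  then have lim: "((\<lambda>x. poly (?R p') x / poly (?R r') x) \<longlongrightarrow> of_rat v) (at (of_rat a))"
    using 1 by (simp add: poly_map_poly_of_rat of_rat_divide)
  let ?Z = "{x. poly (?R r * ?R r') x = 0}"
  have "eventually (\<lambda>x. x \<notin> ?Z - {of_rat a}) (nhds (of_rat a))"
    using poly_roots_finite[OF nz]
    by (intro eventually_nhds_in_open[of "- (?Z - {of_rat a})", unfolded Compl_iff]
          open_Compl finite_imp_closed finite_Diff) auto
  then have "eventually (\<lambda>x. poly (?R p') x / poly (?R r') x = poly (?R p) x / poly (?R r) x)
               (at (of_rat a))"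
    unfolding eventually_at_filter
  proof eventually_elim
    case (elim x)
    have "poly (?R p) x * poly (?R r') x = poly (?R p') x * poly (?R r) x"
      using eq by (metis poly_mult)
    then show ?case using elim by (auto simp: field_simps)
  qed
  with lim show ?thesis by (rule Lim_transform_eventually)
qed


text \<open>
  The exponents of \<open>t\<close> and \<open>-1\<close> are integers that may be negative, hence \<open>powi\<close>; the exponent
  \<open>\<tau> n(n-1)/2 + n\<^sup>2/2\<close> of \<open>q\<close> is doubled because the base is \<open>t = q\<^sup>1\<^sup>/\<^sup>2\<close>.
\<close>

definition Z_series :: "int \<Rightarrow> ratfun fps" where
  "Z_series \<tau> = Abs_fps (\<lambda>n.
     (-1) powi (int n * (\<tau> - 1)) * q_half powi (int n * (int n - 1) * \<tau> + int n ^ 2)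
       / (\<Prod>k=1..n. 1 - q_var ^ k))"

definition f_ratfun :: "nat \<Rightarrow> int \<Rightarrow> ratfun" where
  "f_ratfun m \<tau> = (q_half - inverse q_half) * plethystic_Log (Z_series \<tau>) $ m"

end

theory Submission
  imports Defs "HOL-Number_Theory.Cong"
begin

text \<open>
  Write \<open>Z\<close> for the series inside \<open>Log\<close>. Comparing consecutive coefficients gives the functional equation
  \<open>Z (q x) = Z x + (-1)\<^sup>\<tau> q\<^sup>1\<^sup>/\<^sup>2 x Z (q ^ (\<tau> + 1) x)\<close>. The coefficients of \<open>Z\<close> have poles of
  growing order at \<open>q = 1\<close>. However, dividing the equation by \<open>Z x\<close> shows recursively that the ratio
  \<open>Z (q x) / Z x\<close> is regular there. Since \<open>Z (q ^ k x) / Z x\<close> is a product of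
  dilated copies of that ratio or of their inverses, the value \<open>y\<close> of \<open>Z (q x) / Z x\<close> at
  \<open>q = 1\<close> satisfies \<open>y = 1 + (-1)\<^sup>\<tau> x y ^ (\<tau> + 1)\<close> (\<open>dilation_ratio_Z_series_limit\<close>).
  
  Now \<open>log (Z (q x)) - log (Z x)\<close> has the value \<open>log y\<close>, and its \<open>n\<close>-th coefficient is \<open>q ^ n - 1\<close> times
  that of \<open>log Z\<close>. Hence the coefficients of \<open>log Z\<close> have at most simple poles, and Lagrange inversion
  (\<open>lagrange_log_deriv_nth\<close>) gives
  \<open>(q - 1) [x ^ n] log Z = (-1) ^ (n \<tau>) (n (\<tau> + 1) - 1 gchoose n - 1) / n\<^sup>2\<close> at \<open>q = 1\<close>
  (\<open>fps_log_Z_series_residue\<close>). The substitution \<open>\<Psi>\<^sub>d\<close> divides such a value by \<open>d\<close>, and summing the terms of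
  \<open>Log\<close> yields the formula.
  
  For integrality let \<open>b d = (-1) ^ (d \<tau>) (d (\<tau> + 1) - 1 gchoose d - 1)\<close>, where the binomial coefficient is
  the product of the fractions \<open>(d \<tau> + i) / i\<close> over \<open>0 < i < d\<close>. If a prime \<open>p\<close> divides \<open>d\<close>, the multiples of
  \<open>p\<close> among the \<open>i\<close> contribute the product for \<open>d / p\<close>, and pairing the remaining \<open>i\<close> with \<open>d - i\<close> shows that
  \<open>b d\<close> and \<open>b (d / p)\<close> agree modulo the square of the \<open>p\<close>-part of \<open>d\<close> (\<open>shifted_binomial_cong\<close>). In the
  Moebius sum these differences are all that remains at the prime \<open>p\<close>, so \<open>m\<^sup>2\<close> divides it
  (\<open>square_dvd_moebius_sum\<close>).
\<close>

section \<open>Moebius sums\<close>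

lemma moebius_mu_eq_0: "\<not> squarefree n \<Longrightarrow> moebius_mu n = 0"
  by (simp add: moebius_mu_def)

lemma moebius_mu_prime_mult:
  assumes "prime p" "\<not> p dvd c"
  shows "moebius_mu (p * c) = - moebius_mu c"
proof (cases "c = 0")
  case True
  then show ?thesis using assms by simp
next
  case False
  have cop: "coprime p c"
    using assms by (simp add: prime_imp_coprime)
  have "squarefree (p * c) \<longleftrightarrow> squarefree c"
    using cop assms(1)
    by (metis squarefree_mult_coprime squarefree_multD(2) squarefree_prime)
  moreover have "prime_factors (p * c) = insert p (prime_factors c)"
    using assms False by (subst prime_factors_product) (auto simp: prime_prime_factors)
  moreover have "p \<notin> prime_factors c"
    using assms by auto
  ultimately show ?thesis
    by (simp add: moebius_mu_def)
qed

text \<open>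
  Only squarefree \<open>c\<close> contribute, and those divisible by \<open>p\<close> are exactly the \<open>p c'\<close> with
  \<open>p\<close> not dividing \<open>c'\<close>; since \<open>\<mu> (p c') = - \<mu> c'\<close>, the terms of \<open>c'\<close> and \<open>p c'\<close> combine into
  a difference.
\<close>

lemma moebius_sum_split_prime:
  fixes b :: "nat \<Rightarrow> int"
  assumes "m \<ge> 1" "prime p" "p dvd m"
  shows "(\<Sum>c | c dvd m. moebius_mu c * b (m div c)) =
           (\<Sum>c | c dvd m \<and> \<not> p dvd c. moebius_mu c * (b (m div c) - b (m div c div p)))"
proof -
  let ?f = "\<lambda>c. moebius_mu c * b (m div c)"
  let ?N = "{c. c dvd m \<and> \<not> p dvd c}" and ?D = "{c. c dvd m \<and> p dvd c}"
  have fin: "finite {c. c dvd m}"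
    using assms by simp
  have finN: "finite ?N" and finD: "finite ?D"
    by (rule finite_subset[OF _ fin]; force)+
  have "(\<Sum>c | c dvd m. ?f c) = sum ?f ?N + sum ?f ?D"
    by (subst sum.union_disjoint[symmetric, OF finN finD]) (auto intro: sum.cong)
  also have "sum ?f ?D = sum ?f ((*) p ` ?N)"
  proof (rule sum.mono_neutral_right[OF finD])
    show "(*) p ` ?N \<subseteq> ?D"
      using assms by (auto intro!: divides_mult prime_imp_coprime)
    show "\<forall>c\<in>?D - (*) p ` ?N. ?f c = 0"
    proof
      fix c assume c: "c \<in> ?D - (*) p ` ?N"
      then obtain c' where c': "c = p * c'" by auto
      have "c' dvd m" using c c' by (auto dest: dvd_mult_right)
      then have "p dvd c'" using c c' by auto
      then have "p\<^sup>2 dvd c" using c' by (simp add: power2_eq_square)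
      then have "\<not> squarefree c"
        using assms(2) by (metis not_prime_unit squarefree_def)
      then show "?f c = 0" by (simp add: moebius_mu_eq_0)
    qed
  qed
  also have "\<dots> = (\<Sum>c\<in>?N. ?f (p * c))"
    using assms by (subst sum.reindex) (auto simp: inj_on_def)
  also have "\<dots> = (\<Sum>c\<in>?N. - (moebius_mu c * b (m div c div p)))"
  proof (rule sum.cong)
    fix c assume "c \<in> ?N"
    moreover have "m div (p * c) = m div c div p"
      by (simp add: div_mult2_eq mult.commute[of p])
    ultimately show "?f (p * c) = - (moebius_mu c * b (m div c div p))"
      using assms by (simp add: moebius_mu_prime_mult)
  qed simp
  finally show ?thesis
    by (simp add: sum.distrib[symmetric] algebra_simps)
qed

text \<open>
  After grouping the terms of \<open>c\<close> and \<open>p c\<close>, every difference compares \<open>b d\<close> with \<open>b (d div p)\<close> at some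
  \<open>d = m div c\<close> that carries the full power of \<open>p\<close> in \<open>m\<close>. So the local congruence at each prime
  gives the divisibility by the corresponding prime power of \<open>m\<^sup>2\<close>.
\<close>

lemma square_dvd_moebius_sum:
  fixes b :: "nat \<Rightarrow> int"
  assumes "m \<ge> 1"
    and cong: "\<And>p d. prime p \<Longrightarrow> p dvd d \<Longrightarrow> d \<ge> 1 \<Longrightarrow>
                 [b d = b (d div p)] (mod int p ^ (2 * multiplicity p d))"
  shows "int m ^ 2 dvd (\<Sum>d | d dvd m. moebius_mu (m div d) * b d)"
proof -
  let ?S = "\<Sum>d | d dvd m. moebius_mu (m div d) * b d"
  have S: "?S = (\<Sum>c | c dvd m. moebius_mu c * b (m div c))"
    using assms(1)
    by (intro sum.reindex_bij_witness[of _ "\<lambda>c. m div c" "\<lambda>d. m div d"])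
       (auto simp: div_div_eq_right)
  have prime_part: "int p ^ (2 * multiplicity p m) dvd ?S" if p: "prime p" "p dvd m" for p
    unfolding S moebius_sum_split_prime[OF assms(1) p]
  proof (rule dvd_sum)
    fix c assume "c \<in> {c. c dvd m \<and> \<not> p dvd c}"
    then have c: "c dvd m" "\<not> p dvd c" by auto
    then obtain d where d: "m = c * d" by auto
    have nz: "c \<noteq> 0" "d \<noteq> 0" using d assms(1) by auto
    have "multiplicity p m = multiplicity p d"
      using p(1) c nz d by (simp add: prime_elem_multiplicity_mult_distrib not_dvd_imp_multiplicity_0)
    moreover have "p dvd d" using p c d by (auto simp: prime_dvd_mult_iff)
    ultimately have "int p ^ (2 * multiplicity p m) dvd b d - b (d div p)"
      using cong[of p d] p nz by (simp add: cong_iff_dvd_diff)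
    then show "int p ^ (2 * multiplicity p m) dvd
                 moebius_mu c * (b (m div c) - b (m div c div p))"
      using d nz by simp
  qed
  have "m ^ 2 dvd nat \<bar>?S\<bar>"
  proof (cases "?S = 0")
    case False
    show ?thesis
    proof (rule multiplicity_le_imp_dvd)
      show "m ^ 2 \<noteq> 0" using assms(1) by simp
      fix p :: nat assume p: "prime p"
      show "multiplicity p (m ^ 2) \<le> multiplicity p (nat \<bar>?S\<bar>)"
      proof (cases "p dvd m")
        case True
        have "int (p ^ (2 * multiplicity p m)) dvd ?S"
          using prime_part[OF p True] by simp
        then have "p ^ (2 * multiplicity p m) dvd nat \<bar>?S\<bar>"
          by (simp only: dvd_nat_abs_iff)
        then have "2 * multiplicity p m \<le> multiplicity p (nat \<bar>?S\<bar>)"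
          using False p by (intro multiplicity_geI) auto
        then show ?thesis
          using p assms(1) by (simp add: prime_elem_multiplicity_power_distrib)
      next
        case False
        then show ?thesis
          using p by (simp add: not_dvd_imp_multiplicity_0 prime_dvd_power_iff)
      qed
    qed
  qed auto
  then show ?thesis
    by (simp add: dvd_nat_abs_iff)
qed

section \<open>A congruence between binomial coefficients\<close>

definition parity_sign :: "int \<Rightarrow> int" where
  "parity_sign n = (if even n then 1 else -1)"

text \<open>
  The binomial coefficient of \<open>d (\<tau> + 1) - 1\<close> over \<open>d - 1\<close>, written as the product of the fractions
  \<open>(d \<tau> + i) / i\<close>. In this form the reflection of \<open>i\<close> to \<open>d - i\<close> and the restriction to
  multiples of a prime act on numerator and denominator alike.
\<close>

definition shifted_binomial :: "int \<Rightarrow> nat \<Rightarrow> int" where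
  "shifted_binomial \<tau> d = (\<Prod>i\<in>{1..<d}. int d * \<tau> + int i) div (\<Prod>i\<in>{1..<d}. int i)"

lemma shifted_binomial_mult_prod:
  "shifted_binomial \<tau> d * (\<Prod>i\<in>{1..<d}. int i) = (\<Prod>i\<in>{1..<d}. int d * \<tau> + int i)"
proof (cases "d \<ge> 1")
  case True
  have "(\<Prod>i\<in>{1..<d}. int i) = fact (d - 1)"
    using True by (simp add: fact_prod atLeastLessThanSuc_atLeastAtMost[symmetric])
  moreover have "(\<Prod>i\<in>{1..<d}. int d * \<tau> + int i) = pochhammer (int d * \<tau> + 1) (d - 1)"
    unfolding pochhammer_prod
    by (intro prod.reindex_bij_witness[of _ Suc "\<lambda>i. i - 1"]) auto
  moreover have "fact (d - 1) dvd pochhammer (int d * \<tau> + 1) (d - 1)"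
    using fact_dvd_pochhammer[of "d - 1" "int d * \<tau> + 1"] .
  ultimately show ?thesis by (simp add: shifted_binomial_def)
qed (simp add: shifted_binomial_def)

lemma of_int_shifted_binomial:
  assumes "d \<ge> 1"
  shows "of_int (shifted_binomial \<tau> d) = (of_int (int d * (\<tau> + 1) - 1) gchoose (d - 1) :: 'a :: field_char_0)"
proof -
  let ?a = "of_int (int d * (\<tau> + 1) - 1) :: 'a"
  have fact: "(\<Prod>i\<in>{1..<d}. int i) = fact (d - 1)"
    using assms by (simp add: fact_prod atLeastLessThanSuc_atLeastAtMost[symmetric])
  have "of_int (shifted_binomial \<tau> d) * fact (d - 1) = (of_int (\<Prod>i\<in>{1..<d}. int d * \<tau> + int i) :: 'a)"
    unfolding shifted_binomial_mult_prod[symmetric] fact by simp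
  also have "\<dots> = (\<Prod>i = 0..<d - 1. ?a - of_nat i)"
    unfolding of_int_prod
    by (intro prod.reindex_bij_witness[of _ "\<lambda>i. d - 1 - i" "\<lambda>i. d - 1 - i"])
       (auto simp: of_nat_diff algebra_simps)
  also have "\<dots> = (?a gchoose (d - 1)) * fact (d - 1)"
    by (simp add: gbinomial_mult_fact')
  finally show ?thesis by (subst (asm) mult_cancel_right) simp
qed

lemma prod_split_multiples:
  fixes f :: "nat \<Rightarrow> int"
  assumes "p \<ge> 1"
  shows "(\<Prod>i\<in>{1..<p * e}. f i) = (\<Prod>j\<in>{1..<e}. f (p * j)) * (\<Prod>i | i \<in> {1..<p * e} \<and> \<not> p dvd i. f i)"
proof -
  have "(\<Prod>i\<in>{1..<p * e}. f i) = (\<Prod>i | i \<in> {1..<p * e} \<and> p dvd i. f i) * (\<Prod>i | i \<in> {1..<p * e} \<and> \<not> p dvd i. f i)"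
    by (subst prod.union_disjoint[symmetric]) (auto intro: prod.cong)
  also have "(\<Prod>i | i \<in> {1..<p * e} \<and> p dvd i. f i) = (\<Prod>j\<in>{1..<e}. f (p * j))"
    using assms by (intro prod.reindex_bij_witness[of _ "\<lambda>j. p * j" "\<lambda>i. i div p"]) (auto elim!: dvdE)
  finally show ?thesis .
qed

text \<open>
  As \<open>p\<close> divides \<open>d\<close>, the reflection of \<open>i\<close> to \<open>d - i\<close> preserves the indices prime to \<open>p\<close>. Its only
  possible fixed point is \<open>d / 2\<close>, which is prime to \<open>p\<close> only if \<open>p = 2\<close> and \<open>d / 2\<close> is odd.
\<close>

lemma prod_reflection_pairing:
  fixes f :: "nat \<Rightarrow> int"
  assumes p: "p dvd d"
  shows "(\<Prod>i | i \<in> {1..<d} \<and> \<not> p dvd i. f i) =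
           (\<Prod>i | i \<in> {1..<d} \<and> \<not> p dvd i \<and> 2 * i < d. f i * f (d - i)) *
           (\<Prod>i | i \<in> {1..<d} \<and> \<not> p dvd i \<and> 2 * i = d. f i)"
proof -
  let ?L = "{i. i \<in> {1..<d} \<and> \<not> p dvd i \<and> 2 * i < d}"
  let ?E = "{i. i \<in> {1..<d} \<and> \<not> p dvd i \<and> 2 * i = d}"
  let ?G = "{i. i \<in> {1..<d} \<and> \<not> p dvd i \<and> d < 2 * i}"
  have fin: "finite ?L" "finite ?G" "finite ?E" by simp_all
  have disj: "?L \<inter> ?G = {}" "(?L \<union> ?G) \<inter> ?E = {}"
    by (simp_all add: disjoint_iff)
  have reflect: "\<not> p dvd d - i" if "\<not> p dvd i" "i < d" for i
    using that p dvd_diffD1[of p d i] by auto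
  have G: "prod f ?G = (\<Prod>i\<in>?L. f (d - i))"
  proof (rule prod.reindex_bij_witness[of _ "\<lambda>i. d - i" "\<lambda>i. d - i"])
    show "d - i \<in> ?L" if "i \<in> ?G" for i
      using that reflect[of i] by simp linarith
    show "d - i \<in> ?G" if "i \<in> ?L" for i
      using that reflect[of i] by simp linarith
  qed simp_all
  have "{i. i \<in> {1..<d} \<and> \<not> p dvd i} = (?L \<union> ?G) \<union> ?E" by auto
  then have "(\<Prod>i | i \<in> {1..<d} \<and> \<not> p dvd i. f i) = prod f ((?L \<union> ?G) \<union> ?E)"
    by (rule arg_cong)
  also have "\<dots> = prod f ?L * prod f ?G * prod f ?E"
    unfolding prod.union_disjoint[OF finite_UnI[OF fin(1,2)] fin(3) disj(2)]
      prod.union_disjoint[OF fin(1,2) disj(1)] ..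
  finally show ?thesis
    unfolding G prod.distrib .
qed

text \<open>
  The reflected product is what raises the modulus from \<open>d\<close> to \<open>d\<^sup>2\<close>: the two terms linear in
  \<open>d \<tau>\<close> add up to \<open>d \<tau> i + d \<tau> (d - i) = d\<^sup>2 \<tau>\<close>.
\<close>

lemma shifted_factor_pair_cong:
  assumes "i \<le> d"
  shows "[(int d * \<tau> + int i) * (int d * \<tau> + int (d - i)) = int i * int (d - i)] (mod int d ^ 2)"
proof -
  have "(int d * \<tau> + int i) * (int d * \<tau> + int (d - i)) - int i * int (d - i) = int d ^ 2 * (\<tau> * (\<tau> + 1))"
    using assms by (simp add: of_nat_diff algebra_simps power2_eq_square)
  then show ?thesis by (simp add: cong_iff_dvd_diff)
qed

text \<open>
  The reflected pairs do not see the shift by \<open>d \<tau>\<close>. A fixed point \<open>h = d / 2\<close> occurs only for \<open>p = 2\<close> and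
  odd \<open>h\<close>; there the modulus is 4 and the factor \<open>d \<tau> + h = h (2 \<tau> + 1)\<close> is congruent to
  \<open>(-1)\<^sup>\<tau> h\<close>. This is the origin of the sign, whose exponent \<open>d - d / p\<close> is even in all other cases.
\<close>

lemma shifted_prod_cong:
  assumes p: "prime p" "p dvd d" "d \<ge> 1"
  shows "[(\<Prod>i | i \<in> {1..<d} \<and> \<not> p dvd i. int d * \<tau> + int i) =
            parity_sign \<tau> ^ (d - d div p) * (\<Prod>i | i \<in> {1..<d} \<and> \<not> p dvd i. int i)]
          (mod int p ^ (2 * multiplicity p d))"
    (is "[?N = ?s * ?P] (mod ?M)")
proof -
  let ?L = "{i. i \<in> {1..<d} \<and> \<not> p dvd i \<and> 2 * i < d}"
  let ?E = "{i. i \<in> {1..<d} \<and> \<not> p dvd i \<and> 2 * i = d}"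
  have Md: "?M dvd int d ^ 2"
    using multiplicity_dvd[of p d]
    by (simp add: power_mult mult.commute[of 2]) (metis int_dvd_int_iff of_nat_power dvd_power_same)
  have pairs: "[(\<Prod>i\<in>?L. (int d * \<tau> + int i) * (int d * \<tau> + int (d - i))) =
                (\<Prod>i\<in>?L. int i * int (d - i))] (mod ?M)"
    by (rule cong_dvd_modulus[OF _ Md], rule cong_prod, rule shifted_factor_pair_cong) simp
  have middle: "[(\<Prod>i\<in>?E. int d * \<tau> + int i) = ?s * (\<Prod>i\<in>?E. int i)] (mod ?M)"
  proof (cases "p = 2 \<and> odd (d div 2)")
    case True
    define h where "h = d div 2"
    have h: "d = 2 * h" "odd h" "p = 2" using True p by (auto simp: h_def)
    have E: "?E = {h}" using h by (auto elim: oddE)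
    have "h > 0" using h(2) by (rule odd_pos)
    then have "multiplicity 2 (2 * h) = Suc (multiplicity 2 h)"
      by (intro multiplicity_times_same) auto
    then have mult: "multiplicity p d = 1"
      using h by (simp add: not_dvd_imp_multiplicity_0)
    have "[2 * \<tau> + 1 = parity_sign \<tau>] (mod 4)"
    proof (cases "even \<tau>")
      case True
      then show ?thesis by (auto simp: parity_sign_def cong_iff_dvd_diff)
    next
      case False
      then obtain k where "\<tau> = 2 * k + 1" by (rule oddE)
      then have "2 * \<tau> + 1 - parity_sign \<tau> = 4 * (k + 1)" by (simp add: parity_sign_def)
      then show ?thesis unfolding cong_iff_dvd_diff by (rule dvdI)
    qed
    then have scaled: "[int h * (2 * \<tau> + 1) = int h * parity_sign \<tau>] (mod 4)"
      by (rule cong_scalar_left)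
    have "d - d div p = h" using h(1,3) by simp
    then have "?s = parity_sign \<tau>" using h(2) by (simp add: parity_sign_def)
    then have "?s * (\<Prod>i\<in>?E. int i) = int h * parity_sign \<tau>"
      unfolding E by simp
    moreover have "(\<Prod>i\<in>?E. int d * \<tau> + int i) = int h * (2 * \<tau> + 1)"
      unfolding E using h(1) by (simp add: algebra_simps)
    moreover have "?M = 4" using mult h(3) by simp
    ultimately show ?thesis using scaled by (simp only:)
  next
    case False
    have E: "?E = {}"
    proof safe
      fix i assume i: "\<not> p dvd i" "d = 2 * i"
      then have "p dvd 2" using p by (auto simp: prime_dvd_mult_iff)
      then have "p = 2" using p(1) by (simp add: primes_dvd_imp_eq)
      then show "i \<in> {}" using i False by auto
    qed
    have "even (d - d div p)"
    proof (cases "p = 2")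
      case True
      then show ?thesis using p False by auto
    next
      case False
      then have "odd p" using p(1) prime_odd_nat prime_ge_2_nat[of p] by force
      obtain e where "d = p * e" using p by auto
      then have "d - d div p = (p - 1) * e"
        using p by (simp add: algebra_simps)
      then show ?thesis using \<open>odd p\<close> by simp
    qed
    then have "?s = 1" by (auto simp: parity_sign_def)
    then show ?thesis unfolding E by simp
  qed
  show ?thesis
    using cong_mult[OF pairs middle]
    unfolding prod_reflection_pairing[OF p(2)] by (simp only: mult_ac)
qed

text \<open>
  In the product of the \<open>(d \<tau> + i) / i\<close> the indices \<open>i = p j\<close> contribute exactly the product for
  \<open>d / p\<close>. The remaining indices have denominators prime to \<open>p\<close>, so the quotient of their numerators
  and denominators is, by the reflection argument, a sign modulo the required power of \<open>p\<close>.
\<close>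

lemma shifted_binomial_cong:
  assumes p: "prime p" "p dvd d" "d \<ge> 1"
  shows "[parity_sign \<tau> ^ d * shifted_binomial \<tau> d =
          parity_sign \<tau> ^ (d div p) * shifted_binomial \<tau> (d div p)]
         (mod int p ^ (2 * multiplicity p d))"
proof -
  define e where "e = d div p"
  have d: "d = p * e"
    using p by (simp add: e_def)
  let ?A = "{i. i \<in> {1..<d} \<and> \<not> p dvd i}"
  define N where "N = (\<Prod>i\<in>?A. int d * \<tau> + int i)"
  define P where "P = (\<Prod>i\<in>?A. int i)"
  define Q where "Q = int p ^ (e - 1) * (\<Prod>j\<in>{1..<e}. int j)"
  let ?s = "parity_sign \<tau>"
  have Q: "Q \<noteq> 0" using p by (auto simp: Q_def)
  have QP: "(\<Prod>i\<in>{1..<d}. int i) = Q * P"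
    using prod_split_multiples[of p int e] p prime_ge_1_nat[of p]
    by (simp add: Q_def P_def d prod.distrib)
  have QN: "(\<Prod>i\<in>{1..<d}. int d * \<tau> + int i) =
      int p ^ (e - 1) * (\<Prod>j\<in>{1..<e}. int e * \<tau> + int j) * N"
  proof -
    have "(\<Prod>j\<in>{1..<e}. int d * \<tau> + int (p * j)) = int p ^ (e - 1) * (\<Prod>j\<in>{1..<e}. int e * \<tau> + int j)"
    proof -
      have "(\<Prod>j\<in>{1..<e}. int d * \<tau> + int (p * j)) = (\<Prod>j\<in>{1..<e}. int p * (int e * \<tau> + int j))"
        by (simp add: d algebra_simps)
      then show ?thesis by (simp only: prod.distrib prod_constant card_atLeastLessThan)
    qed
    then show ?thesis
      using prod_split_multiples[of p "\<lambda>i. int d * \<tau> + int i" e] p prime_ge_1_nat[of p]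
      by (simp add: N_def d)
  qed
  have "Q * (shifted_binomial \<tau> d * P) = shifted_binomial \<tau> d * (\<Prod>i\<in>{1..<d}. int i)"
    unfolding QP by (simp only: mult_ac)
  also have "\<dots> = int p ^ (e - 1) * (shifted_binomial \<tau> e * (\<Prod>j\<in>{1..<e}. int j)) * N"
    by (simp only: shifted_binomial_mult_prod QN)
  also have "\<dots> = Q * (shifted_binomial \<tau> e * N)"
    unfolding Q_def by (simp only: mult_ac)
  finally have "Q * (shifted_binomial \<tau> d * P) = Q * (shifted_binomial \<tau> e * N)" .
  then have BP: "shifted_binomial \<tau> d * P = shifted_binomial \<tau> e * N"
    using Q by simp
  have "[shifted_binomial \<tau> e * N = shifted_binomial \<tau> e * (?s ^ (d - e) * P)] (mod int p ^ (2 * multiplicity p d))"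
    using shifted_prod_cong[OF p, of \<tau>] unfolding N_def P_def e_def by (rule cong_scalar_left)
  then have "[P * shifted_binomial \<tau> d = P * (?s ^ (d - e) * shifted_binomial \<tau> e)] (mod int p ^ (2 * multiplicity p d))"
    unfolding BP[symmetric] by (simp only: mult_ac)
  moreover have "coprime P (int p ^ (2 * multiplicity p d))"
  proof -
    have "coprime (int i) (int p)" if "\<not> p dvd i" for i
      using that p(1) by (metis coprime_commute coprime_int_iff prime_imp_coprime)
    then have "coprime P (int p)" unfolding P_def by (intro prod_coprime_left) auto
    then show ?thesis by simp
  qed
  ultimately have "[shifted_binomial \<tau> d = ?s ^ (d - e) * shifted_binomial \<tau> e] (mod int p ^ (2 * multiplicity p d))"
    by (simp add: cong_mult_lcancel)
  then have "[?s ^ d * shifted_binomial \<tau> d = ?s ^ d * (?s ^ (d - e) * shifted_binomial \<tau> e)] (mod int p ^ (2 * multiplicity p d))"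
    by (rule cong_scalar_left)
  moreover have "?s ^ d * ?s ^ (d - e) = ?s ^ e"
  proof -
    have "e \<le> d" by (simp add: e_def)
    then have "d + (d - e) = e + 2 * (d - e)" by simp
    then have "?s ^ d * ?s ^ (d - e) = ?s ^ e * (?s\<^sup>2) ^ (d - e)"
      by (metis power_add power_mult)
    then show ?thesis by (simp add: parity_sign_def split: if_splits)
  qed
  ultimately show ?thesis by (simp add: e_def mult.assoc[symmetric])
qed

section \<open>Lagrange inversion for the logarithmic derivative\<close>

lemma fls_deriv_compose_fps:
  fixes A :: "'a :: field_char_0 fls"
  assumes "w $ 0 = 0" "w \<noteq> 0"
  shows "fls_deriv (fls_compose_fps A w) = fls_compose_fps (fls_deriv A) w * fls_deriv (fps_to_fls w)"
proof -
  \<comment> \<open>Multiplying by a power of \<open>X\<close> reduces the claim to the chain rule for power series.\<close>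
  define k where "k = nat (- fls_subdegree A)"
  define F where "F = fls_regpart (fls_X ^ k * A)"
  let ?W = "fps_to_fls w"
  have Wnz: "?W \<noteq> 0" using assms by simp
  have "fls_X ^ k * A = fps_to_fls F"
  proof (cases "A = 0")
    case False
    then have "fls_subdegree (fls_X ^ k * A) \<ge> 0" by (simp add: k_def)
    then show ?thesis by (simp add: F_def)
  qed (simp add: F_def)
  then have F: "fps_to_fls F = fls_X ^ k * A" by simp
  let ?B = "fls_compose_fps A w"
  have FB: "fps_to_fls (F oo w) = ?W ^ k * ?B"
    using assms by (simp flip: fls_compose_fps_to_fls add: F fls_compose_fps_mult fls_compose_fps_power)
  have "fls_deriv (?W ^ k * ?B) = fps_to_fls ((fps_deriv F oo w) * fps_deriv w)"
    using assms by (simp flip: FB add: fls_deriv_fps_to_fls fps_compose_deriv)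
  also have "\<dots> = fls_compose_fps (fls_deriv (fps_to_fls F)) w * fls_deriv ?W"
    using assms by (simp add: fls_deriv_fps_to_fls fls_times_fps_to_fls)
  also have "\<dots> = (of_nat k * ?W ^ (k - 1) * ?B + ?W ^ k * fls_compose_fps (fls_deriv A) w) * fls_deriv ?W"
    using assms by (simp add: F fls_deriv_power fls_compose_fps_mult fls_compose_fps_add fls_compose_fps_power algebra_simps)
  finally have "?W ^ k * fls_deriv ?B = ?W ^ k * (fls_compose_fps (fls_deriv A) w * fls_deriv ?W)"
    by (simp add: fls_deriv_power algebra_simps)
  then show ?thesis using Wnz by simp
qed

text \<open>
  Up to a multiple of \<open>1 / X\<close>, a Laurent series is a derivative. Derivatives stay derivatives under
  substitution and have residue 0, while \<open>1 / X\<close> becomes the logarithmic derivative of \<open>w\<close>, whose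
  residue is the order of \<open>w\<close>.
\<close>

lemma fls_residue_change_of_variable:
  fixes F :: "'a :: field_char_0 fls"
  assumes w: "w $ 0 = 0" "w \<noteq> 0"
  shows "fls_residue (fls_compose_fps F w * fls_deriv (fps_to_fls w)) =
           fls_residue F * of_int (int (subdegree w))"
proof -
  define c where "c = fls_residue F"
  have "fls_residue (F - fls_const c * fls_X_inv) = 0"
    by (simp add: c_def)
  then obtain A where A: "fls_deriv A = F - fls_const c * fls_X_inv"
    using fls_residue_nonzero_ex_antiderivative by blast
  have "F = fls_deriv A + fls_const c * inverse fls_X"
    by (simp add: A fls_inverse_X)
  then have "fls_compose_fps F w * fls_deriv (fps_to_fls w) =
      fls_deriv (fls_compose_fps A w) + fls_const c * (fls_deriv (fps_to_fls w) * inverse (fps_to_fls w))"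
    using w by (simp add: fls_deriv_compose_fps fls_compose_fps_add fls_compose_fps_mult
        fls_compose_fps_inverse algebra_simps)
  then show ?thesis
    using fls_residue_deriv_times_inverse_eq_subdegree(1)[of "fps_to_fls w"]
    by (simp only: fls_residue_add fls_residue_deriv fls_residue_fls_const_times)
       (simp add: c_def fls_subdegree_fls_to_fps)
qed

lemma fps_to_fls_binomial_compose:
  fixes w :: "'a :: field_char_0 fps"
  assumes "w $ 0 = 0"
  shows "fps_to_fls (fps_binomial (of_int k) oo w) = fps_to_fls (1 + w) powi k"
proof -
  have nat: "fps_binomial (of_nat n) oo w = (1 + w) ^ n" for n
    using assms by (simp add: fps_binomial_of_nat fps_compose_power[symmetric] fps_compose_add_distrib)
  show ?thesis
  proof (cases "k \<ge> 0")
    case True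
    then obtain n where "k = int n" using nonneg_int_cases by blast
    then show ?thesis by (simp add: nat fps_to_fls_power)
  next
    case False
    then obtain n where k: "k = - int n" by (metis int_cases2 of_nat_0_le_iff)
    have "(fps_binomial (of_int k) oo w) * (fps_binomial (of_nat n) oo w) = 1"
      using assms k by (simp flip: fps_compose_mult_distrib fps_binomial_add_mult)
    then have "fps_to_fls (fps_binomial (of_int k) oo w) * fps_to_fls (1 + w) ^ n = 1"
      by (metis nat fps_to_fls_eq_1_iff fls_times_fps_to_fls fps_to_fls_power)
    then show ?thesis
      using k by (simp add: power_int_minus) (metis inverse_unique mult.commute)
  qed
qed

text \<open>
  The coefficient is the residue of \<open>w' / (1 + w) / X ^ n\<close>. The equation for \<open>w\<close> gives
  \<open>1 / X = s (1 + w) ^ a / w\<close>, so this residue is that of \<open>s ^ n (1 + w) ^ (n a - 1) / w ^ n\<close>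
  times \<open>w'\<close>, and by the change of variable it is a coefficient of the binomial series in \<open>w\<close>.
\<close>

lemma lagrange_log_deriv_nth:
  fixes w :: "'a :: field_char_0 fps"
  assumes w: "w = fps_const s * fps_X * (fps_binomial (of_int a) oo w)" and s: "s \<noteq> 0" and n: "n \<ge> 1"
  shows "(fps_deriv (1 + w) * inverse (1 + w)) $ (n - 1) = s ^ n * (of_int (int n * a - 1) gchoose (n - 1))"
proof -
  have w0: "w $ 0 = 0" by (subst w) simp
  have w1: "w $ 1 = s" by (subst w) (simp add: mult.assoc)
  then have wnz: "w \<noteq> 0" using s by auto
  have sub: "subdegree w = 1" using w0 w1 s by (intro subdegreeI) auto
  define W where "W = fps_to_fls w"
  have W: "W = fls_const s * fls_X * (1 + W) powi a"
    unfolding W_def by (subst w) (simp add: fls_times_fps_to_fls fps_to_fls_binomial_compose[OF w0])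
  have Wnz: "W \<noteq> 0" using wnz by (simp add: W_def)
  have Ynz: "1 + W \<noteq> 0"
  proof
    assume "1 + W = 0"
    then have "fps_to_fls (1 + w) = 0" by (simp add: W_def)
    then have "(1 + w) $ 0 = 0" by (simp only: fps_to_fls_eq_0_iff fps_zero_nth)
    then show False using w0 by simp
  qed
  define F where "F = fls_const (s ^ n) * (inverse fls_X) ^ n * fps_to_fls (fps_binomial (of_int (int n * a - 1) :: 'a))"
  have sub': "inverse fls_X ^ n = fls_const (s ^ n) * inverse W ^ n * (1 + W) powi (int n * a)"
  proof -
    have "W ^ n = fls_const (s ^ n) * fls_X ^ n * (1 + W) powi (int n * a)"
      by (subst W) (simp add: power_mult_distrib fls_const_power power_int_mult mult.commute[of "int n"])
    moreover have "inverse x ^ n = c * inverse v ^ n * y" if "x \<noteq> 0" "v \<noteq> 0" "v ^ n = c * x ^ n * y"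
      for x v c y :: "'a fls"
      using that by (auto simp: field_simps)
    ultimately show ?thesis
      using Wnz fls_X_nonzero by blast
  qed
  have "(fps_deriv (1 + w) * inverse (1 + w)) $ (n - 1) =
      fls_residue (fps_to_fls (fps_deriv (1 + w) * inverse (1 + w)) * inverse fls_X ^ n)"
    using n by (simp add: fls_inverse_X fls_X_inv_power_times_conv_shift nat_diff_distrib)
  also have "fps_to_fls (fps_deriv (1 + w) * inverse (1 + w)) = fls_deriv W * inverse (1 + W)"
    using w0 fls_inverse_fps_to_fls[of "1 + w"] subdegree_eq_0[of "1 + w"]
    by (simp add: W_def fls_times_fps_to_fls fls_deriv_fps_to_fls)
  also have "\<dots> * inverse fls_X ^ n = fls_compose_fps F w * fls_deriv W"
  proof -
    have "fls_compose_fps F w = fls_const (s ^ n) * inverse W ^ n * (1 + W) powi (int n * a - 1)"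
      using w0 wnz fps_to_fls_binomial_compose[OF w0, of "int n * a - 1"]
      by (simp add: F_def fls_compose_fps_mult fls_compose_fps_power fls_compose_fps_inverse W_def)
    then show ?thesis
      unfolding sub' using Ynz by (simp add: power_int_diff divide_inverse mult_ac)
  qed
  also have "fls_residue \<dots> = fls_residue F"
    unfolding W_def using fls_residue_change_of_variable[OF w0 wnz, of F] sub by simp
  also have "\<dots> = s ^ n * (of_int (int n * a - 1) gchoose (n - 1))"
    using n
    by (simp add: F_def fls_inverse_X fls_X_inv_power_times_conv_shift mult.assoc fls_shifted_times_simps nat_diff_distrib)
  finally show ?thesis .
qed

section \<open>Values of rational functions\<close>

lemma ratfun_has_value_0: "ratfun_has_value 0 a 0"
  unfolding ratfun_has_value_def by (intro exI[of _ 0] exI[of _ 1]) (simp add: Zero_fract_def)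

lemma ratfun_has_value_1: "ratfun_has_value 1 a 1"
  unfolding ratfun_has_value_def by (intro exI[of _ 1]) (simp add: One_fract_def)

lemma ratfun_has_value_add:
  assumes "ratfun_has_value f a v" "ratfun_has_value g a w"
  shows "ratfun_has_value (f + g) a (v + w)"
proof -
  obtain p r p' r' where "f = Fract p r" "poly r a \<noteq> 0" "v = poly p a / poly r a"
      "g = Fract p' r'" "poly r' a \<noteq> 0" "w = poly p' a / poly r' a"
    using assms by (auto simp: ratfun_has_value_def)
  moreover from this have "r \<noteq> 0" "r' \<noteq> 0" by auto
  ultimately show ?thesis
    unfolding ratfun_has_value_def
    by (intro exI[of _ "p * r' + p' * r"] exI[of _ "r * r'"]) (simp add: add_frac_eq)
qed

lemma ratfun_has_value_mult:
  assumes "ratfun_has_value f a v" "ratfun_has_value g a w"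
  shows "ratfun_has_value (f * g) a (v * w)"
proof -
  obtain p r p' r' where "f = Fract p r" "poly r a \<noteq> 0" "v = poly p a / poly r a"
      "g = Fract p' r'" "poly r' a \<noteq> 0" "w = poly p' a / poly r' a"
    using assms by (auto simp: ratfun_has_value_def)
  then show ?thesis
    unfolding ratfun_has_value_def
    by (intro exI[of _ "p * p'"] exI[of _ "r * r'"]) simp
qed

lemma ratfun_has_value_uminus:
  assumes "ratfun_has_value f a v"
  shows "ratfun_has_value (- f) a (- v)"
proof -
  obtain p r where "f = Fract p r" "poly r a \<noteq> 0" "v = poly p a / poly r a"
    using assms by (auto simp: ratfun_has_value_def)
  then show ?thesis
    unfolding ratfun_has_value_def by (intro exI[of _ "- p"] exI[of _ r]) simp
qed

lemma ratfun_has_value_inverse: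
  assumes "ratfun_has_value f a v" "v \<noteq> 0"
  shows "ratfun_has_value (inverse f) a (inverse v)"
proof -
  obtain p r where "f = Fract p r" "poly r a \<noteq> 0" "v = poly p a / poly r a"
    using assms by (auto simp: ratfun_has_value_def)
  then show ?thesis
    using assms(2) unfolding ratfun_has_value_def by (intro exI[of _ r] exI[of _ p]) simp
qed

lemma ratfun_has_value_nonzero:
  assumes "ratfun_has_value f a v" "v \<noteq> 0"
  shows "f \<noteq> 0"
  using assms ratfun_has_value_unique[OF ratfun_has_value_0, of a v] by auto

lemma ratfun_has_value_sum:
  assumes "\<And>i. i \<in> A \<Longrightarrow> ratfun_has_value (f i) a (v i)"
  shows "ratfun_has_value (sum f A) a (sum v A)"
  using assms
  by (induction A rule: infinite_finite_induct) (auto intro: ratfun_has_value_0 ratfun_has_value_add)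

lemma ratfun_has_value_power:
  assumes "ratfun_has_value f a v"
  shows "ratfun_has_value (f ^ n) a (v ^ n)"
  using assms by (induction n) (auto intro: ratfun_has_value_1 ratfun_has_value_mult)

lemma ratfun_has_value_of_nat: "ratfun_has_value (of_nat n) a (of_nat n)"
  by (induction n) (auto intro: ratfun_has_value_0 ratfun_has_value_1 ratfun_has_value_add)

lemma ratfun_has_value_of_int: "ratfun_has_value (of_int k) a (of_int k)"
proof (cases k rule: int_cases2)
  case (nonneg n)
  then show ?thesis by (simp add: ratfun_has_value_of_nat)
next
  case (nonpos n)
  then show ?thesis using ratfun_has_value_uminus[OF ratfun_has_value_of_nat] by simp
qed

lemma ratfun_has_value_q_half: "ratfun_has_value q_half 1 1"
  unfolding ratfun_has_value_def q_half_def by (intro exI[of _ "[:0, 1:]"] exI[of _ 1]) simp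

lemma q_half_nonzero: "q_half \<noteq> 0"
  using ratfun_has_value_nonzero[OF ratfun_has_value_q_half] by simp

lemma ratfun_has_value_q_var: "ratfun_has_value q_var 1 1"
  unfolding q_var_def using ratfun_has_value_power[OF ratfun_has_value_q_half, of 2] by simp

lemma ratfun_has_value_q_var_powi: "ratfun_has_value (q_var powi k) 1 1"
proof (cases k rule: int_cases2)
  case (nonneg n)
  then show ?thesis using ratfun_has_value_power[OF ratfun_has_value_q_var, of n] by simp
next
  case (nonpos n)
  then show ?thesis
    using ratfun_has_value_inverse[OF ratfun_has_value_power[OF ratfun_has_value_q_var, of n]]
    by (simp add: power_int_minus)
qed

lemma q_number_has_value: "ratfun_has_value (\<Sum>j<n. q_var ^ j) 1 (of_nat n)"
  using ratfun_has_value_sum[of "{..<n}" "\<lambda>j. q_var ^ j" 1 "\<lambda>j. 1"]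
    ratfun_has_value_power[OF ratfun_has_value_q_var] by simp

lemma ratfun_subst_power_mult:
  assumes "d \<ge> 1"
  shows "ratfun_subst_power d (f * g) = ratfun_subst_power d f * ratfun_subst_power d g"
proof -
  obtain a b where f: "f = Fract a b" "b \<noteq> 0" by (cases f)
  obtain a' b' where g: "g = Fract a' b'" "b' \<noteq> 0" by (cases g)
  show ?thesis
    using f g assms by (simp add: ratfun_subst_power_Fract pcompose_mult)
qed

lemma ratfun_subst_power_q_var_minus_1:
  assumes "d \<ge> 1"
  shows "ratfun_subst_power d (q_var - 1) = q_var ^ d - 1"
proof -
  have pow: "q_var ^ n = Fract (monom 1 (2 * n)) 1" for n
  proof -
    have "q_half ^ k = Fract (monom 1 k) 1" for k
      by (induction k) (simp_all add: One_fract_def q_half_def monom_Suc)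
    from this[of "2 * n"] show ?thesis by (simp only: q_var_def power_mult)
  qed
  have *: "q_var ^ n - 1 = Fract (monom 1 (2 * n) - 1) 1" for n
    unfolding pow One_fract_def by (simp del: fract_collapse)
  have "pcompose (monom 1 (2 * 1) - 1) (monom 1 d) = (monom 1 (2 * d) - 1 :: rat poly)"
    by (rule poly_eq_poly_eq_iff[THEN iffD1], rule ext)
       (simp add: poly_pcompose poly_monom mult.commute[of 2] flip: power_mult)
  then show ?thesis
    using *[of 1] *[of d] assms by (simp add: ratfun_subst_power_Fract pcompose_1)
qed

lemma ratfun_subst_power_has_value:
  assumes "ratfun_has_value f 1 v" "d \<ge> 1"
  shows "ratfun_has_value (ratfun_subst_power d f) 1 v"
proof -
  obtain p r where "f = Fract p r" "poly r 1 \<noteq> 0" "v = poly p 1 / poly r 1"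
    using assms by (auto simp: ratfun_has_value_def)
  moreover from this have "r \<noteq> 0" by auto
  ultimately show ?thesis
    using assms(2) unfolding ratfun_has_value_def
    by (intro exI[of _ "pcompose p (monom 1 d)"] exI[of _ "pcompose r (monom 1 d)"])
       (simp add: ratfun_subst_power_Fract poly_pcompose poly_monom)
qed

section \<open>Power series with coefficients regular at 1\<close>

text \<open>
  The truncation at \<open>n\<close> serves for series known only through a functional equation that determines
  each coefficient from the preceding ones: their regularity is proved by induction on \<open>n\<close>.
\<close>

definition fps_value_upto :: "nat \<Rightarrow> ratfun fps \<Rightarrow> rat fps \<Rightarrow> bool" where
  "fps_value_upto n F G \<longleftrightarrow> (\<forall>k\<le>n. ratfun_has_value (F $ k) 1 (G $ k))"

lemma fps_value_upto_1: "fps_value_upto n 1 1"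
  by (auto simp: fps_value_upto_def ratfun_has_value_0 ratfun_has_value_1)

lemma fps_value_upto_mult:
  assumes "fps_value_upto n F G" "fps_value_upto n F' G'"
  shows "fps_value_upto n (F * F') (G * G')"
  using assms unfolding fps_value_upto_def fps_mult_nth
  by (auto intro!: ratfun_has_value_sum ratfun_has_value_mult)

lemma fps_value_upto_inverse:
  assumes "fps_value_upto n F G" "G $ 0 \<noteq> 0"
  shows "fps_value_upto n (inverse F) (inverse G)"
proof -
  have F: "ratfun_has_value (F $ k) 1 (G $ k)" if "k \<le> n" for k
    using assms(1) that by (simp add: fps_value_upto_def)
  have F0: "F $ 0 \<noteq> 0" using F[of 0] assms(2) ratfun_has_value_nonzero by blast
  have "ratfun_has_value (inverse F $ k) 1 (inverse G $ k)" if "k \<le> n" for k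
    using that
  proof (induction k rule: less_induct)
    case (less k)
    show ?case
    proof (cases "k = 0")
      case True
      then show ?thesis
        using ratfun_has_value_inverse[OF F[of 0] assms(2)] by simp
    next
      case False
      \<comment> \<open>The same recursion computes the coefficients of the inverse over both fields.\<close>
      have rec: "inverse H $ k = inverse (H $ 0) * - (\<Sum>i = 1..k. H $ i * inverse H $ (k - i))"
        if "H $ 0 \<noteq> 0" for H :: "'a :: field fps"
      proof -
        have "0 = (H * inverse H) $ k"
          using that False by (simp add: inverse_mult_eq_1')
        also have "\<dots> = H $ 0 * inverse H $ k + (\<Sum>i = 1..k. H $ i * inverse H $ (k - i))"
          by (simp add: fps_mult_nth sum.atLeast_Suc_atMost)
        finally have "H $ 0 * inverse H $ k = - (\<Sum>i = 1..k. H $ i * inverse H $ (k - i))"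
          by (simp add: eq_neg_iff_add_eq_0)
        then show ?thesis using that by (simp add: field_simps)
      qed
      show ?thesis
        unfolding rec[OF F0] rec[OF assms(2)]
        using less False
        by (intro ratfun_has_value_mult ratfun_has_value_uminus ratfun_has_value_sum
              ratfun_has_value_inverse F assms(2) less.IH) auto
    qed
  qed
  then show ?thesis by (simp add: fps_value_upto_def)
qed

section \<open>The dilations of x by powers of q\<close>

definition q_dilate :: "int \<Rightarrow> ratfun fps \<Rightarrow> ratfun fps" where
  "q_dilate k F = F oo (fps_const (q_var powi k) * fps_X)"

lemma q_var_nonzero: "q_var \<noteq> 0"
  using q_half_nonzero by (simp add: q_var_def)

lemma q_dilate_nth: "q_dilate k F $ n = q_var powi (k * int n) * F $ n"
  by (simp add: q_dilate_def fps_compose_linear power_int_mult)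

lemma q_dilate_mult: "q_dilate k (F * G) = q_dilate k F * q_dilate k G"
  by (simp add: q_dilate_def fps_compose_mult_distrib)

lemma q_dilate_inverse: "F $ 0 \<noteq> 0 \<Longrightarrow> q_dilate k (inverse F) = inverse (q_dilate k F)"
  by (simp add: q_dilate_def fps_inverse_compose)

lemma q_dilate_q_dilate: "q_dilate j (q_dilate k F) = q_dilate (j + k) F"
  by (rule fps_ext) (simp add: q_dilate_nth power_int_add q_var_nonzero algebra_simps)

lemma q_dilate_0: "q_dilate 0 F = F"
  by (rule fps_ext) (simp add: q_dilate_nth)

lemma fps_value_upto_q_dilate:
  assumes "fps_value_upto n F G"
  shows "fps_value_upto n (q_dilate k F) G"
  using assms ratfun_has_value_mult[OF ratfun_has_value_q_var_powi]
  by (fastforce simp: fps_value_upto_def q_dilate_nth)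

lemma fps_deriv_q_dilate: "fps_deriv (q_dilate k F) = fps_const (q_var powi k) * q_dilate k (fps_deriv F)"
  by (rule fps_ext)
     (simp add: q_dilate_nth power_int_add q_var_nonzero algebra_simps)

text \<open>
  The value at 1 of the ratio \<open>F (q^k x) / F x\<close> may exist although the coefficients of \<open>F\<close> have poles
  there, which is the reason for working with these ratios instead of \<open>F\<close>.
\<close>

definition dilation_ratio :: "ratfun fps \<Rightarrow> int \<Rightarrow> ratfun fps" where
  "dilation_ratio F k = q_dilate k F * inverse F"

lemma dilation_ratio_0: "F $ 0 \<noteq> 0 \<Longrightarrow> dilation_ratio F 0 = 1"
  by (simp add: dilation_ratio_def q_dilate_0 inverse_mult_eq_1')

lemma dilation_ratio_nth_0: "F $ 0 \<noteq> 0 \<Longrightarrow> dilation_ratio F k $ 0 = 1"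
  by (simp add: dilation_ratio_def q_dilate_nth)

lemma dilation_ratio_add:
  assumes "F $ 0 \<noteq> 0"
  shows "dilation_ratio F (k + j) = dilation_ratio F k * q_dilate k (dilation_ratio F j)"
proof -
  have "(q_dilate k F) $ 0 \<noteq> 0" using assms by (simp add: q_dilate_nth)
  then have "q_dilate k F * inverse (q_dilate k F) = 1" by (rule inverse_mult_eq_1')
  moreover have "x * u = a * u * (x * b)" if "a * b = 1" for a b x u :: "ratfun fps"
  proof -
    have "a * u * (x * b) = (a * b) * (x * u)" by (simp only: mult_ac)
    then show ?thesis by (simp add: that)
  qed
  ultimately show ?thesis
    unfolding dilation_ratio_def q_dilate_mult q_dilate_inverse[OF assms] q_dilate_q_dilate
    by blast
qed

text \<open>
  At \<open>q = 1\<close> the dilations become trivial, so the cocycle identity \<open>dilation_ratio_add\<close> turns into the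
  law of powers: the ratio for \<open>k\<close> has as its value the \<open>k\<close>-th power of the ratio for 1. The
  binomial series composed with \<open>y - 1\<close> expresses this power uniformly in the sign of \<open>k\<close>.
\<close>

lemma dilation_ratio_value_upto:
  assumes F: "F $ 0 \<noteq> 0" and y: "fps_value_upto n (dilation_ratio F 1) y" "y $ 0 = 1"
  shows "fps_value_upto n (dilation_ratio F k) (fps_binomial (of_int k) oo (y - 1))"
proof (induction k rule: int_induct[where k = 0])
  case base
  show ?case using F by (simp add: dilation_ratio_0 fps_value_upto_1)
next
  case (step1 i)
  have "fps_binomial (of_int (i + 1)) oo (y - 1) = (fps_binomial (of_int i) oo (y - 1)) * y"
    using y(2) by (simp add: fps_binomial_add_mult fps_compose_mult_distrib fps_binomial_1 fps_compose_add_distrib)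
  then show ?case
    using fps_value_upto_mult[OF step1(2) fps_value_upto_q_dilate[OF y(1)]]
    by (simp add: dilation_ratio_add[OF F])
next
  case (step2 i)
  have inv: "(fps_binomial (of_int (i - 1)) oo (y - 1)) * y = fps_binomial (of_int i) oo (y - 1)"
    using y(2) fps_binomial_add_mult[of "of_int (i - 1)" "1 :: rat"]
    by (simp add: fps_compose_mult_distrib fps_binomial_1 fps_compose_add_distrib)
  have "fps_binomial (of_int (i - 1)) oo (y - 1) = (fps_binomial (of_int i) oo (y - 1)) * inverse y"
    unfolding inv[symmetric] using y(2) by (simp add: mult.assoc inverse_mult_eq_1')
  moreover have "dilation_ratio F (i - 1) =
      dilation_ratio F i * inverse (q_dilate (i - 1) (dilation_ratio F 1))"
  proof -
    let ?R = "q_dilate (i - 1) (dilation_ratio F 1)"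
    have "?R $ 0 \<noteq> 0" using F by (simp add: q_dilate_nth dilation_ratio_nth_0)
    then show ?thesis
      using dilation_ratio_add[OF F, of "i - 1" 1] by (simp add: mult.assoc inverse_mult_eq_1')
  qed
  moreover have "fps_value_upto n (inverse (q_dilate (i - 1) (dilation_ratio F 1))) (inverse y)"
    using fps_value_upto_inverse[OF fps_value_upto_q_dilate[OF y(1)]] y(2) by simp
  ultimately show ?case
    using fps_value_upto_mult[OF step2(2)] by simp
qed

section \<open>The functional equation of the series\<close>

lemma Z_series_nth_0: "Z_series \<tau> $ 0 = 1"
  by (simp add: Z_series_def)

lemma q_var_powi: "q_var powi k = q_half powi (2 * k)"
  by (simp add: q_var_def power_int_mult)

lemma neg_one_powi: "(-1 :: 'a :: field) powi k = of_int (parity_sign k)"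
  by (auto simp: parity_sign_def power_int_minus_left)

lemma q_number_mult: "(q_var - 1) * (\<Sum>j<n. q_var ^ j) = q_var ^ n - 1"
  by (simp add: power_diff_1_eq)

lemma q_var_power_neq_1:
  assumes "n \<ge> 1"
  shows "q_var ^ n \<noteq> 1"
proof -
  have "q_var - 1 \<noteq> 0"
  proof
    assume "q_var - 1 = 0"
    then have "Fract [:0, 0, 1:] 1 = (Fract 1 1 :: ratfun)"
      by (simp add: q_var_def q_half_def power2_eq_square fract_collapse)
    then have "[:0, 0, 1:] = (1 :: rat poly)" by (simp add: eq_fract)
    then have "degree [:0, 0, 1 :: rat:] = degree (1 :: rat poly)" by (rule arg_cong)
    then show False by simp
  qed
  moreover have "(\<Sum>j<n. q_var ^ j) \<noteq> 0"
    using ratfun_has_value_nonzero[OF q_number_has_value] assms by simp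
  ultimately show ?thesis
    using q_number_mult[of n] by (metis mult_eq_0_iff right_minus_eq)
qed

lemma Z_series_recurrence:
  "(1 - q_var ^ Suc n) * Z_series \<tau> $ Suc n =
     - of_int (parity_sign \<tau>) * q_half * q_var powi ((\<tau> + 1) * int n) * Z_series \<tau> $ n"
proof -
  have sign: "(-1 :: ratfun) powi (int (Suc n) * (\<tau> - 1)) =
      - of_int (parity_sign \<tau>) * (-1) powi (int n * (\<tau> - 1))"
  proof -
    have "int (Suc n) * (\<tau> - 1) = int n * (\<tau> - 1) + (\<tau> - 1)" by (simp add: algebra_simps)
    then have "(-1 :: ratfun) powi (int (Suc n) * (\<tau> - 1)) = (-1) powi (int n * (\<tau> - 1)) * (-1) powi (\<tau> - 1)"
      by (metis power_int_add zero_neq_neg_one)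
    also have "(-1 :: ratfun) powi (\<tau> - 1) = - of_int (parity_sign \<tau>)"
      by (simp add: neg_one_powi parity_sign_def)
    finally show ?thesis by simp
  qed
  have "int (Suc n) * (int (Suc n) - 1) * \<tau> + int (Suc n) ^ 2 =
      1 + 2 * ((\<tau> + 1) * int n) + (int n * (int n - 1) * \<tau> + int n ^ 2)"
    by (simp add: algebra_simps power2_eq_square)
  moreover have "q_half powi (a + b) = q_half powi a * q_half powi b" for a b
    by (simp add: power_int_add q_half_nonzero)
  ultimately have exponent: "q_half powi (int (Suc n) * (int (Suc n) - 1) * \<tau> + int (Suc n) ^ 2) =
      q_half * q_var powi ((\<tau> + 1) * int n) * q_half powi (int n * (int n - 1) * \<tau> + int n ^ 2)"
    by (simp only: q_var_powi power_int_1_right)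
  have "1 - q_var ^ Suc n \<noteq> 0" using q_var_power_neq_1[of "Suc n"] by simp
  moreover have "x * (s * t / (p * x)) = s * t / p" if "x \<noteq> 0" for x s t p :: ratfun
    using that by (simp add: divide_simps)
  ultimately have "(1 - q_var ^ Suc n) * Z_series \<tau> $ Suc n =
    (-1) powi (int (Suc n) * (\<tau> - 1)) *
      q_half powi (int (Suc n) * (int (Suc n) - 1) * \<tau> + int (Suc n) ^ 2) / (\<Prod>k=1..n. 1 - q_var ^ k)"
    unfolding Z_series_def fps_nth_Abs_fps by (simp only: prod.nat_ivl_Suc') simp
  also have "\<dots> = - of_int (parity_sign \<tau>) * q_half * q_var powi ((\<tau> + 1) * int n) * Z_series \<tau> $ n"
    unfolding Z_series_def fps_nth_Abs_fps sign exponent by simp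
  finally show ?thesis .
qed

lemma Z_series_functional_equation:
  "q_dilate 1 (Z_series \<tau>) =
     Z_series \<tau> + fps_const (of_int (parity_sign \<tau>) * q_half) * fps_X * q_dilate (\<tau> + 1) (Z_series \<tau>)"
proof (rule fps_ext)
  fix n
  show "q_dilate 1 (Z_series \<tau>) $ n =
     (Z_series \<tau> + fps_const (of_int (parity_sign \<tau>) * q_half) * fps_X * q_dilate (\<tau> + 1) (Z_series \<tau>)) $ n"
  proof (cases n)
    case 0
    then show ?thesis by (simp add: q_dilate_nth mult.assoc)
  next
    case (Suc m)
    have "x * z = z - (1 - x) * z" for x z :: ratfun
      by (simp add: left_diff_distrib)
    then have "q_var ^ Suc m * Z_series \<tau> $ Suc m =
        Z_series \<tau> $ Suc m - (1 - q_var ^ Suc m) * Z_series \<tau> $ Suc m"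
      .
    also have "\<dots> = Z_series \<tau> $ Suc m + of_int (parity_sign \<tau>) * q_half *
        (q_var powi ((\<tau> + 1) * int m) * Z_series \<tau> $ m)"
      unfolding Z_series_recurrence by (simp only: mult_minus_left diff_minus_eq_add mult.assoc)
    finally have rec: "q_var ^ Suc m * Z_series \<tau> $ Suc m = Z_series \<tau> $ Suc m +
        of_int (parity_sign \<tau>) * q_half * (q_var powi ((\<tau> + 1) * int m) * Z_series \<tau> $ m)" .
    have "q_dilate 1 (Z_series \<tau>) $ n = q_var ^ Suc m * Z_series \<tau> $ Suc m"
      unfolding Suc q_dilate_nth mult_1 power_int_of_nat ..
    then show ?thesis
      unfolding rec unfolding Suc by (simp add: q_dilate_nth mult.assoc del: of_nat_Suc power_Suc)
  qed
qed

lemma dilation_ratio_Z_series: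
  "dilation_ratio (Z_series \<tau>) 1 =
     1 + fps_const (of_int (parity_sign \<tau>) * q_half) * fps_X * dilation_ratio (Z_series \<tau>) (\<tau> + 1)"
proof -
  have "Z_series \<tau> * inverse (Z_series \<tau>) = 1"
    by (simp add: inverse_mult_eq_1' Z_series_nth_0)
  then show ?thesis
    unfolding dilation_ratio_def Z_series_functional_equation by (simp add: distrib_right mult.assoc)
qed

text \<open>
  The factor \<open>x\<close> in the functional equation makes the induction work: the coefficients of the ratio for 1
  up to \<open>n + 1\<close> are determined by those of the ratio for \<open>\<tau> + 1\<close> up to \<open>n\<close>, which in turn depend
  only on the ratio for 1 up to \<open>n\<close>.
\<close>

lemma dilation_ratio_Z_series_value_upto:
  "\<exists>y. y $ 0 = 1 \<and> fps_value_upto n (dilation_ratio (Z_series \<tau>) 1) y"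
proof (induction n)
  case 0
  show ?case
    by (intro exI[of _ 1]) (simp add: fps_value_upto_def dilation_ratio_nth_0 Z_series_nth_0 ratfun_has_value_1)
next
  case (Suc n)
  then obtain y where y: "y $ 0 = 1" "fps_value_upto n (dilation_ratio (Z_series \<tau>) 1) y" by blast
  define B where "B = fps_binomial (of_int (\<tau> + 1)) oo (y - 1)"
  let ?R = "dilation_ratio (Z_series \<tau>)"
  let ?y = "1 + fps_const (of_int (parity_sign \<tau>)) * fps_X * B"
  have B: "fps_value_upto n (?R (\<tau> + 1)) B"
    unfolding B_def using y by (intro dilation_ratio_value_upto) (simp_all add: Z_series_nth_0)
  have "ratfun_has_value (?R 1 $ k) 1 (?y $ k)" if "k \<le> Suc n" for k
  proof (cases k)
    case 0
    then show ?thesis by (simp add: dilation_ratio_nth_0 Z_series_nth_0 ratfun_has_value_1)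
  next
    case (Suc j)
    have "ratfun_has_value (of_int (parity_sign \<tau>) * q_half * ?R (\<tau> + 1) $ j) 1 (of_int (parity_sign \<tau>) * 1 * B $ j)"
      using B Suc that
      by (intro ratfun_has_value_mult ratfun_has_value_of_int ratfun_has_value_q_half) (simp add: fps_value_upto_def)
    then show ?thesis
      by (subst dilation_ratio_Z_series) (simp add: Suc mult.assoc)
  qed
  then show ?case
    by (intro exI[of _ ?y]) (simp add: fps_value_upto_def)
qed

text \<open>
  At \<open>q = 1\<close> the functional equation degenerates to the algebraic equation
  \<open>y = 1 + (-1)\<^sup>\<tau> x y ^ (\<tau> + 1)\<close>.
\<close>

lemma dilation_ratio_Z_series_limit:
  obtains y where "y $ 0 = 1" "\<And>n. fps_value_upto n (dilation_ratio (Z_series \<tau>) 1) y"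
    "y - 1 = fps_const (of_int (parity_sign \<tau>)) * fps_X * (fps_binomial (of_int (\<tau> + 1)) oo (y - 1))"
proof -
  let ?R = "dilation_ratio (Z_series \<tau>)"
  have "\<forall>n. \<exists>v. ratfun_has_value (?R 1 $ n) 1 v"
    using dilation_ratio_Z_series_value_upto[of _ \<tau>] by (auto simp: fps_value_upto_def)
  then obtain v where v: "\<And>n. ratfun_has_value (?R 1 $ n) 1 (v n)" by metis
  define y where "y = Abs_fps v"
  have upto: "fps_value_upto n (?R 1) y" for n
    by (simp add: fps_value_upto_def y_def v)
  have y0: "y $ 0 = 1"
    using v[of 0] ratfun_has_value_unique[OF _ ratfun_has_value_1]
    by (simp add: y_def dilation_ratio_nth_0 Z_series_nth_0)
  define B where "B = fps_binomial (of_int (\<tau> + 1)) oo (y - 1)"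
  have B: "fps_value_upto n (?R (\<tau> + 1)) B" for n
    unfolding B_def using upto y0 by (intro dilation_ratio_value_upto) (simp_all add: Z_series_nth_0)
  have "(y - 1) $ n = (fps_const (of_int (parity_sign \<tau>)) * fps_X * B) $ n" for n
  proof (cases n)
    case 0
    then show ?thesis by (simp add: y0 mult.assoc)
  next
    case (Suc j)
    have "ratfun_has_value (of_int (parity_sign \<tau>) * q_half * ?R (\<tau> + 1) $ j) 1 (of_int (parity_sign \<tau>) * 1 * B $ j)"
      using B[of j]
      by (intro ratfun_has_value_mult ratfun_has_value_of_int ratfun_has_value_q_half) (simp add: fps_value_upto_def)
    then have "ratfun_has_value (?R 1 $ n) 1 (of_int (parity_sign \<tau>) * B $ j)"
      by (subst dilation_ratio_Z_series) (simp add: Suc mult.assoc)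
    then have "y $ n = of_int (parity_sign \<tau>) * B $ j"
      using ratfun_has_value_unique[OF v[of n]] by (simp add: y_def)
    then show ?thesis using Suc by (simp add: mult.assoc)
  qed
  then have "y - 1 = fps_const (of_int (parity_sign \<tau>)) * fps_X * B" by (rule fps_ext)
  then show ?thesis using that[OF y0 upto] by (simp add: B_def)
qed

section \<open>The simple pole of the logarithm\<close>

lemma fps_deriv_fps_log:
  assumes "F $ 0 = 1"
  shows "fps_deriv (fps_log F) = fps_deriv F * inverse F"
proof -
  have "inverse (1 + fps_X) oo (F - 1) = inverse F"
    using assms by (simp add: fps_inverse_compose fps_compose_add_distrib)
  then show ?thesis
    using assms by (simp add: fps_log_def fps_compose_deriv fps_ln_deriv mult.commute)
qed

text \<open>
  Both sides are the derivative of \<open>log (F (q x)) - log (F x)\<close>. In differentiated form the product rule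
  takes the place of the multiplicativity of the logarithm.
\<close>

lemma log_deriv_dilation_ratio:
  assumes F: "F $ 0 = 1"
  defines "L \<equiv> fps_deriv (fps_log F)"
  shows "fps_deriv (dilation_ratio F 1) * inverse (dilation_ratio F 1) =
           fps_const q_var * q_dilate 1 L - L"
proof -
  let ?G = "q_dilate 1 F"
  have nz: "F $ 0 \<noteq> 0" "?G $ 0 \<noteq> 0" using F by (simp_all add: q_dilate_nth)
  have L: "L = fps_deriv F * inverse F" unfolding L_def by (rule fps_deriv_fps_log[OF F])
  have inv: "inverse (dilation_ratio F 1) = inverse ?G * F"
    unfolding dilation_ratio_def using nz by (simp add: fps_inverse_mult fps_inverse_idempotent)
  have GL: "q_dilate 1 L = q_dilate 1 (fps_deriv F) * inverse ?G"
    unfolding L by (simp add: q_dilate_mult q_dilate_inverse nz)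
  have "fps_deriv (dilation_ratio F 1) =
      fps_const q_var * q_dilate 1 (fps_deriv F) * inverse F - ?G * (fps_deriv F * inverse F * inverse F)"
    unfolding dilation_ratio_def using nz
    by (simp add: fps_deriv_q_dilate fps_inverse_deriv power2_eq_square algebra_simps)
  moreover have "(c * d * u - g * (f' * u * u)) * (h * f) = c * (d * h) - f' * u"
    if "f * u = 1" "g * h = 1" for c d u g f' h f :: "ratfun fps"
  proof -
    have "(c * d * u - g * (f' * u * u)) * (h * f) = c * (d * h) * (f * u) - (g * h) * (f' * u) * (f * u)"
      by (simp add: algebra_simps)
    then show ?thesis by (simp add: that)
  qed
  ultimately show ?thesis
    unfolding inv GL unfolding L
    using inverse_mult_eq_1'[OF nz(1)] inverse_mult_eq_1'[OF nz(2)] by simp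
qed

text \<open>
  The coefficient of \<open>x ^ n\<close> in \<open>log (F (q x)) - log (F x)\<close> is \<open>q ^ n - 1\<close> times that of \<open>log F\<close>. For
  the series \<open>Z\<close> this difference is the logarithm of a series regular at \<open>q = 1\<close>, with value \<open>log y\<close>.
  So \<open>log Z\<close> has at most simple poles, with coefficients read off from \<open>log y\<close> by Lagrange inversion.
  One factor \<open>1 / n\<close> comes from the quotient of \<open>q - 1\<close> by \<open>q ^ n - 1\<close>, the other from
  integrating \<open>y' / y\<close>.
\<close>

lemma fps_log_Z_series_residue:
  assumes "n \<ge> 1"
  shows "ratfun_has_value ((q_var - 1) * fps_log (Z_series \<tau>) $ n) 1
           (of_int (parity_sign \<tau>) ^ n * of_int (shifted_binomial \<tau> n) / of_nat n ^ 2)"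
proof -
  obtain y where y: "y $ 0 = 1" "\<And>n. fps_value_upto n (dilation_ratio (Z_series \<tau>) 1) y"
    "y - 1 = fps_const (of_int (parity_sign \<tau>)) * fps_X * (fps_binomial (of_int (\<tau> + 1)) oo (y - 1))"
    using dilation_ratio_Z_series_limit[of \<tau>] by blast
  let ?R = "dilation_ratio (Z_series \<tau>) 1"
  define L where "L = fps_log (Z_series \<tau>)"
  define S where "S = (\<Sum>j<n. q_var ^ j)"
  let ?b = "of_int (parity_sign \<tau>) ^ n * of_int (shifted_binomial \<tau> n) :: rat"
  have S: "ratfun_has_value S 1 (of_nat n)" unfolding S_def by (rule q_number_has_value)
  have "fps_value_upto n (fps_deriv ?R) (fps_deriv y)"
    unfolding fps_value_upto_def
  proof safe
    fix k
    have "ratfun_has_value (of_nat (k + 1) * ?R $ (k + 1)) 1 (of_nat (k + 1) * y $ (k + 1))"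
      using y(2)[of "k + 1"] by (intro ratfun_has_value_mult ratfun_has_value_of_nat) (simp add: fps_value_upto_def)
    then show "ratfun_has_value (fps_deriv ?R $ k) 1 (fps_deriv y $ k)" by simp
  qed
  moreover have "fps_value_upto n (inverse ?R) (inverse y)"
    using fps_value_upto_inverse[OF y(2)] y(1) by simp
  ultimately have "ratfun_has_value ((fps_deriv ?R * inverse ?R) $ (n - 1)) 1 ((fps_deriv y * inverse y) $ (n - 1))"
    using fps_value_upto_mult unfolding fps_value_upto_def by (metis diff_le_self)
  also have "(fps_deriv y * inverse y) $ (n - 1) = ?b"
    using lagrange_log_deriv_nth[OF y(3) _ assms] of_int_shifted_binomial[OF assms, of \<tau>, where 'a = rat]
    by (simp add: parity_sign_def)
  also have "(fps_deriv ?R * inverse ?R) $ (n - 1) = (q_var ^ n - 1) * (of_nat n * L $ n)"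
  proof -
    have "q_var * q_var ^ (n - 1) = q_var ^ n" using assms by (simp add: power_eq_if)
    then have q: "q_var * (q_var ^ (n - 1) * x) = q_var ^ n * x" for x
      by (simp flip: mult.assoc)
    have "(fps_deriv ?R * inverse ?R) $ (n - 1) =
        (fps_const q_var * q_dilate 1 (fps_deriv L) - fps_deriv L) $ (n - 1)"
      unfolding L_def by (simp only: log_deriv_dilation_ratio[OF Z_series_nth_0])
    also have "\<dots> = q_var * (q_var ^ (n - 1) * (of_nat n * L $ n)) - of_nat n * L $ n"
      using assms by (cases n) (simp_all add: q_dilate_nth)
    finally show ?thesis unfolding q by (simp add: left_diff_distrib)
  qed
  finally have val: "ratfun_has_value ((q_var ^ n - 1) * (of_nat n * L $ n)) 1 ?b" .
  have gen: "inverse s * inverse k * (p * s * (k * l)) = p * l" if "s \<noteq> 0" "k \<noteq> 0" for s k p l :: ratfun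
    using that by (simp add: field_simps)
  have "S \<noteq> 0" using ratfun_has_value_nonzero[OF S] assms by simp
  moreover have "(of_nat n :: ratfun) \<noteq> 0"
    using ratfun_has_value_nonzero[OF ratfun_has_value_of_nat, of n] assms by simp
  moreover have "q_var ^ n - 1 = (q_var - 1) * S"
    unfolding S_def q_number_mult ..
  ultimately have "(q_var - 1) * L $ n = inverse S * inverse (of_nat n) * ((q_var ^ n - 1) * (of_nat n * L $ n))"
    by (simp only: gen not_False_eq_True)
  moreover have "ratfun_has_value \<dots> 1 (inverse (of_nat n) * inverse (of_nat n) * ?b)"
    using assms by (intro ratfun_has_value_mult val ratfun_has_value_inverse S ratfun_has_value_of_nat) simp_all
  moreover have "inverse (of_nat n) * inverse (of_nat n) * ?b = ?b / of_nat n ^ 2"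
    by (simp add: divide_inverse power2_eq_square)
  ultimately show ?thesis by (simp only: L_def)
qed

text \<open>
  Substituting \<open>q ^ d\<close> for \<open>q\<close> leaves values at 1 unchanged but replaces the factor \<open>q - 1\<close> by
  \<open>q ^ d - 1\<close>, and the quotient of the two has the value \<open>1 / d\<close> at 1.
\<close>

lemma ratfun_subst_power_residue:
  assumes "d \<ge> 1" and "ratfun_has_value ((q_var - 1) * f) 1 v"
  shows "ratfun_has_value ((q_var - 1) * ratfun_subst_power d f) 1 (v / of_nat d)"
proof -
  define S where "S = (\<Sum>j<d. q_var ^ j)"
  have S: "ratfun_has_value S 1 (of_nat d)" unfolding S_def by (rule q_number_has_value)
  then have "S \<noteq> 0" using ratfun_has_value_nonzero assms(1) by fastforce
  have "ratfun_subst_power d ((q_var - 1) * f) = (q_var - 1) * S * ratfun_subst_power d f"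
    unfolding S_def q_number_mult
    by (simp only: ratfun_subst_power_mult[OF assms(1)] ratfun_subst_power_q_var_minus_1[OF assms(1)])
  then have "(q_var - 1) * ratfun_subst_power d f = inverse S * ratfun_subst_power d ((q_var - 1) * f)"
    using \<open>S \<noteq> 0\<close> by (simp add: field_simps)
  moreover have "ratfun_has_value \<dots> 1 (inverse (of_nat d) * v)"
    using assms by (intro ratfun_has_value_mult ratfun_has_value_inverse S ratfun_subst_power_has_value) simp_all
  ultimately show ?thesis by (simp add: field_simps)
qed

section \<open>The value at q = 1 and its integrality\<close>

theorem theorem1p6:
  fixes m :: nat and \<tau> :: int
  assumes "m \<ge> 1"
  shows "\<exists>v\<in>\<int>. ratfun_has_value (f_ratfun m \<tau>) 1 v \<and>
           v = 1 / of_nat m ^ 2 *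
                 (\<Sum>d | d dvd m. of_int (moebius_mu (m div d)) * (-1) powi (int d * \<tau>) *
                    (of_int (int d * (\<tau> + 1) - 1) gchoose (d - 1)))"
proof -
  define b where "b d = parity_sign \<tau> ^ d * shifted_binomial \<tau> d" for d
  define T where "T = (\<Sum>d | d dvd m. moebius_mu (m div d) * b d)"
  have b: "of_int (b d) = (-1) powi (int d * \<tau>) * (of_int (int d * (\<tau> + 1) - 1) gchoose (d - 1) :: rat)"
    if "d dvd m" for d
  proof -
    have "d \<ge> 1" using that assms by (cases d) auto
    moreover have "(-1 :: rat) powi (int d * \<tau>) = of_int (parity_sign \<tau>) ^ d"
      by (subst mult.commute) (simp add: power_int_mult neg_one_powi)
    ultimately show ?thesis
      unfolding b_def by (simp only: of_int_mult of_int_power of_int_shifted_binomial)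
  qed
  have "int m ^ 2 dvd T"
    unfolding T_def b_def using assms by (intro square_dvd_moebius_sum shifted_binomial_cong)
  then obtain c where c: "T = int m ^ 2 * c" by (rule dvdE)
  have T: "(\<Sum>d | d dvd m. of_int (moebius_mu (m div d)) * (-1) powi (int d * \<tau>) *
                    (of_int (int d * (\<tau> + 1) - 1) gchoose (d - 1))) = (of_int T :: rat)"
    unfolding T_def of_int_sum by (intro sum.cong) (simp_all add: b)
  define L where "L = fps_log (Z_series \<tau>)"
  \<comment> \<open>The term of \<open>e\<close> in \<open>Log\<close> carries \<open>1 / e\<close> from its definition and \<open>1 / e\<close> from the substitution.\<close>
  \<comment> \<open>With \<open>1 / (m / e)\<^sup>2\<close> from the logarithm, this makes the common denominator \<open>m\<^sup>2\<close>.\<close>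
  define coeff :: "nat \<Rightarrow> rat" where "coeff e = of_int (moebius_mu e) * of_int (b (m div e)) / of_nat m ^ 2" for e
  have term_value: "ratfun_has_value
      ((q_var - 1) * (of_int (moebius_mu (Suc i)) / of_nat (Suc i) * Psi (Suc i) L $ m)) 1
      (if Suc i dvd m then coeff (Suc i) else 0)" for i
  proof (cases "Suc i dvd m")
    case False
    then show ?thesis by (simp add: Psi_def ratfun_has_value_0)
  next
    case True
    then obtain n where n: "m = Suc i * n" by auto
    then have "n \<ge> 1" using assms by (cases n) auto
    have quot: "m div Suc i = n" unfolding n by (rule nonzero_mult_div_cancel_left) simp
    have "ratfun_has_value (of_int (moebius_mu (Suc i)) * inverse (of_nat (Suc i)) *
        ((q_var - 1) * ratfun_subst_power (Suc i) (L $ n))) 1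
        (of_int (moebius_mu (Suc i)) * inverse (of_nat (Suc i)) *
        (of_int (parity_sign \<tau>) ^ n * of_int (shifted_binomial \<tau> n) / of_nat n ^ 2 / of_nat (Suc i)))"
      unfolding L_def
      by (intro ratfun_has_value_mult ratfun_has_value_inverse ratfun_has_value_of_int ratfun_has_value_of_nat
          ratfun_subst_power_residue fps_log_Z_series_residue \<open>n \<ge> 1\<close>) (simp_all del: of_nat_Suc)
    also have "(of_int (moebius_mu (Suc i)) * inverse (of_nat (Suc i)) *
        (of_int (parity_sign \<tau>) ^ n * of_int (shifted_binomial \<tau> n) / of_nat n ^ 2 / of_nat (Suc i))) = coeff (Suc i)"
    proof -
      have "(of_nat m :: rat) = of_nat (Suc i) * of_nat n" unfolding n by (rule of_nat_mult)
      then show ?thesis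
        using \<open>n \<ge> 1\<close> quot by (simp add: coeff_def b_def power2_eq_square field_simps del: of_nat_Suc)
    qed
    also have "of_int (moebius_mu (Suc i)) * inverse (of_nat (Suc i)) * ((q_var - 1) * ratfun_subst_power (Suc i) (L $ n)) =
        (q_var - 1) * (of_int (moebius_mu (Suc i)) / of_nat (Suc i) * Psi (Suc i) L $ m)"
      using True quot by (simp add: Psi_def divide_inverse mult_ac del: of_nat_Suc)
    finally show ?thesis using True by simp
  qed
  have "ratfun_has_value ((q_var - 1) * plethystic_Log (Z_series \<tau>) $ m) 1
      (\<Sum>i<m. if Suc i dvd m then coeff (Suc i) else 0)"
    unfolding plethystic_Log_nth[OF Z_series_nth_0] sum_distrib_left
    using term_value unfolding L_def by (intro ratfun_has_value_sum)
  also have "(\<Sum>i<m. if Suc i dvd m then coeff (Suc i) else 0) = (\<Sum>e | e dvd m. coeff e)"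
  proof -
    have "(\<Sum>i<m. if Suc i dvd m then coeff (Suc i) else 0) = (\<Sum>i | i < m \<and> Suc i dvd m. coeff (Suc i))"
      by (simp add: sum.If_cases lessThan_def Collect_conj_eq)
    also have "\<dots> = (\<Sum>e | e dvd m. coeff e)"
      using assms
      by (intro sum.reindex_bij_witness[of _ "\<lambda>e. e - 1" Suc])
         (auto simp: dvd_imp_le Suc_le_eq dest: dvd_imp_le intro!: Nat.gr0I)
    finally show ?thesis .
  qed
  also have "\<dots> = of_int T / of_nat m ^ 2"
  proof -
    have "(\<Sum>e | e dvd m. coeff e) = (\<Sum>d | d dvd m. coeff (m div d))"
      using assms
      by (intro sum.reindex_bij_witness[of _ "\<lambda>c. m div c" "\<lambda>d. m div d"]) (auto simp: div_div_eq_right)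
    also have "\<dots> = (\<Sum>d | d dvd m. of_int (moebius_mu (m div d) * b d) / of_nat m ^ 2)"
      using assms by (intro sum.cong) (auto simp: coeff_def div_div_eq_right)
    finally show ?thesis by (simp add: T_def sum_divide_distrib)
  qed
  also have "\<dots> = of_int c" using assms by (simp add: c)
  finally have "ratfun_has_value (inverse q_half * ((q_var - 1) * plethystic_Log (Z_series \<tau>) $ m)) 1 (inverse 1 * of_int c)"
    by (intro ratfun_has_value_mult ratfun_has_value_inverse ratfun_has_value_q_half) simp
  \<comment> \<open>\<open>q - 1\<close> differs from the normalising factor only by \<open>t\<close>, which has the value 1.\<close>
  moreover have "inverse q_half * ((q_var - 1) * x) = (q_half - inverse q_half) * x" for x
    using q_half_nonzero by (simp add: q_var_def power2_eq_square field_simps)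
  ultimately have "ratfun_has_value (f_ratfun m \<tau>) 1 (of_int c)"
    by (simp add: f_ratfun_def)
  moreover have "of_int c = 1 / of_nat m ^ 2 * (of_int T :: rat)"
    using assms by (simp add: c)
  ultimately show ?thesis
    unfolding T by (blast intro: Ints_of_int)
qed

end
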